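(* Let $h\ge 3$ be an integer. Let $A=\{a_1,a_2,\ldots,a_{h+1}\}$ be a set of positive integers with $a_1<a_2<\cdots<a_{h+1}$ and $a_i\ge a_{i-1}+a_{i-2}$ for $i=4,\ldots,h+1$. Then $\left|h^{\wedge}_{\pm}A\right|\ge (h+1)^2+1$.
   Context: For a positive integer $h$ and a finite set of integers $A=\{a_1,\ldots,a_k\}$ (distinct elements), the restricted $h$-fold signed sumset is $h^{\wedge}_{\pm}A=\left\{\sum_{i=1}^k\lambda_i a_i:\lambda_i\in\{-1,0,1\},\ \sum_{i=1}^k|\lambda_i|=h\right\}$. *)

theory Defs
  imports Main
begin

(* A coefficient family (lambda_1, ..., lambda_k) for A = {a_1, ..., a_k} is encoded as a function
   on the elements of A themselves; its values outside A are irrelevant. *)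
definition restricted_signed_sumset :: "nat \<Rightarrow> int set \<Rightarrow> int set" where
  "restricted_signed_sumset h A =
     {(\<Sum>a\<in>A. l a * a) | l :: int \<Rightarrow> int.
        (\<forall>a\<in>A. l a \<in> {-1, 0, 1}) \<and> (\<Sum>a\<in>A. \<bar>l a\<bar>) = int h}"

end

theory Submission
  imports Defs
begin

text \<open>
  Induction on \<open>h\<close>. Write \<open>S\<close> for the sumset of the first \<open>h + 1\<close> elements and \<open>b\<close> for the next
  element. The growth condition gives \<open>s < 2b\<close> for all \<open>s \<in> S\<close>, so the translates \<open>s + b\<close> with
  \<open>s \<ge> 0\<close> are disjoint from \<open>S - b\<close>; as \<open>S = -S\<close>, the cardinality grows by a factor of at least
  \<open>3/2\<close>, which suffices from \<open>17\<close> at \<open>h = 3\<close> onwards. For \<open>h = 3\<close> and elements \<open>x < y < z < w\<close>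
  with \<open>w \<ge> y + z\<close>, a decreasing chain of eight nonnegative sums is always avoided by a further
  positive sum.
\<close>

lemma restricted_signed_sumsetI:
  assumes "s = (\<Sum>a\<in>A. l a * a)" "\<forall>a\<in>A. l a \<in> {-1, 0, 1}" "(\<Sum>a\<in>A. \<bar>l a\<bar>) = int h"
  shows "s \<in> restricted_signed_sumset h A"
  using assms unfolding restricted_signed_sumset_def by blast

text \<open>Infinitely many \<open>l\<close> represent the same sum, since values outside
  \<open>A\<close> are free. Setting them to 0 there leaves a finite set of functions.\<close>

lemma finite_restricted_signed_sumset:
  assumes "finite A"
  shows "finite (restricted_signed_sumset h A)"
proof -
  have "restricted_signed_sumset h A
      \<subseteq> (\<lambda>l. \<Sum>a\<in>A. l a * a) ` {l. \<forall>a. (a \<in> A \<longrightarrow> l a \<in> {-1, 0, 1}) \<and> (a \<notin> A \<longrightarrow> l a = 0)}"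
  proof
    fix s assume "s \<in> restricted_signed_sumset h A"
    then obtain l where l: "s = (\<Sum>a\<in>A. l a * a)" "\<forall>a\<in>A. l a \<in> {-1, 0, 1}"
      unfolding restricted_signed_sumset_def by blast
    have "s = (\<Sum>a\<in>A. (if a \<in> A then l a else 0) * a)" using l(1) by simp
    then show "s \<in> (\<lambda>l. \<Sum>a\<in>A. l a * a) `
        {l. \<forall>a. (a \<in> A \<longrightarrow> l a \<in> {-1, 0, 1}) \<and> (a \<notin> A \<longrightarrow> l a = 0)}"
      using l(2) by (intro image_eqI[where x = "\<lambda>a. if a \<in> A then l a else 0"]) auto
  qed
  moreover have "finite {l. \<forall>a. (a \<in> A \<longrightarrow> l a \<in> {-1, 0, 1 :: int}) \<and> (a \<notin> A \<longrightarrow> l a = 0)}"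
    by (intro finite_set_of_finite_funs assms) auto
  ultimately show ?thesis by (meson finite_imageI finite_subset)
qed

lemma uminus_restricted_signed_sumset:
  assumes "s \<in> restricted_signed_sumset h A"
  shows "- s \<in> restricted_signed_sumset h A"
proof -
  from assms obtain l where "s = (\<Sum>a\<in>A. l a * a)"
    "\<forall>a\<in>A. l a \<in> {-1, 0, 1}" "(\<Sum>a\<in>A. \<bar>l a\<bar>) = int h"
    unfolding restricted_signed_sumset_def by blast
  then show ?thesis
    by (intro restricted_signed_sumsetI[where l = "\<lambda>a. - l a"]) (auto simp: sum_negf)
qed

lemma restricted_signed_sumset_le_sum:
  assumes "s \<in> restricted_signed_sumset h A" "\<forall>a\<in>A. a \<ge> 0"
  shows "s \<le> \<Sum>A"
proof -
  from assms obtain l where l: "s = (\<Sum>a\<in>A. l a * a)" "\<forall>a\<in>A. l a \<in> {-1, 0, 1}"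
    unfolding restricted_signed_sumset_def by blast
  have "l a * a \<le> a" if "a \<in> A" for a
    using that l(2) assms(2) by auto
  then show ?thesis unfolding l(1) by (rule sum_mono)
qed

lemma restricted_signed_sumset_insert:
  assumes "s \<in> restricted_signed_sumset h A" "finite A" "b \<notin> A" "e \<in> {-1, 1}"
  shows "s + e * b \<in> restricted_signed_sumset (Suc h) (insert b A)"
proof -
  from assms obtain l where l: "s = (\<Sum>a\<in>A. l a * a)"
    "\<forall>a\<in>A. l a \<in> {-1, 0, 1}" "(\<Sum>a\<in>A. \<bar>l a\<bar>) = int h"
    unfolding restricted_signed_sumset_def by blast
  \<comment> \<open>Stated for a general \<open>f\<close> so that it covers both the weighted sum
    and the sum of absolute values.\<close>
  have eq: "(\<Sum>a\<in>A. f ((l(b := e)) a) a) = (\<Sum>a\<in>A. f (l a) a)" for f :: "int \<Rightarrow> int \<Rightarrow> int"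
    using assms(3) by (intro sum.cong) auto
  have "s + e * b = (\<Sum>a\<in>insert b A. (l(b := e)) a * a)"
    using assms(2,3) l(1) eq[of "\<lambda>u v. u * v"] by simp
  moreover have "(\<Sum>a\<in>insert b A. \<bar>(l(b := e)) a\<bar>) = int (Suc h)"
    using assms(2,3,4) l(3) eq[of "\<lambda>u v. \<bar>u\<bar>"] by auto
  moreover have "\<forall>a\<in>insert b A. (l(b := e)) a \<in> {-1, 0, 1}"
    using assms(4) l(2) by auto
  ultimately show ?thesis
    by (intro restricted_signed_sumsetI[where l = "l(b := e)"])
qed

lemma restricted_signed_sumset_three_of_four:
  assumes "distinct [p, q, r, d]" "e \<in> {-1, 1}" "f \<in> {-1, 1}" "g \<in> {-1, 1}"
  shows "e * p + f * q + g * r \<in> restricted_signed_sumset 3 {p, q, r, d}"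
proof -
  let ?l = "\<lambda>t. if t = p then e else if t = q then f else if t = r then g else 0"
  show ?thesis
    using assms by (intro restricted_signed_sumsetI[where l = ?l]) auto
qed

text \<open>\<open>P\<close> and its mirror image meet at most in 0, which accounts for the
  \<open>+ 1\<close>. Nine nonnegative sums thus force 17 elements.\<close>

lemma card_symmetric_ge:
  fixes S :: "int set"
  assumes "finite S" "\<And>s. s \<in> S \<Longrightarrow> - s \<in> S" "P \<subseteq> S" "\<forall>s\<in>P. s \<ge> 0"
  shows "2 * card P \<le> card S + 1"
proof -
  have fin: "finite P" using assms(1,3) finite_subset by blast
  have "card P + card (uminus ` P) = card (P \<union> uminus ` P) + card (P \<inter> uminus ` P)"
    using fin by (intro card_Un_Int) auto
  moreover have "card (uminus ` P) = card P" by (simp add: card_image)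
  moreover have "card (P \<inter> uminus ` P) \<le> card {0 :: int}"
  proof (rule card_mono)
    show "P \<inter> uminus ` P \<subseteq> {0}"
    proof
      fix s assume "s \<in> P \<inter> uminus ` P"
      then have "s \<ge> 0" "- s \<ge> 0" using assms(4) by auto
      then show "s \<in> {0}" by simp
    qed
  qed simp
  moreover have "card (P \<union> uminus ` P) \<le> card S"
    using assms(1,2,3) by (intro card_mono) auto
  ultimately show ?thesis by simp
qed

lemma card_symmetric_le:
  fixes S :: "int set"
  assumes "finite S" "\<And>s. s \<in> S \<Longrightarrow> - s \<in> S"
  shows "card S \<le> 2 * card {s \<in> S. s \<ge> 0}"
proof -
  let ?P = "{s \<in> S. s \<ge> 0}"
  have "S \<subseteq> ?P \<union> uminus ` ?P"
  proof
    fix s assume "s \<in> S"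
    then show "s \<in> ?P \<union> uminus ` ?P"
      using assms(2) by (cases "s \<ge> 0") (auto intro: image_eqI[where x = "- s"])
  qed
  then have "card S \<le> card (?P \<union> uminus ` ?P)"
    using assms(1) by (intro card_mono) auto
  also have "\<dots> \<le> card ?P + card (uminus ` ?P)" by (rule card_Un_le)
  also have "card (uminus ` ?P) = card ?P" by (simp add: card_image)
  finally show ?thesis by simp
qed

lemma card_restricted_signed_sumset_three:
  fixes x y z w :: int
  assumes "0 < x" "x < y" "y < z" "y + z \<le> w"
  shows "card (restricted_signed_sumset 3 {x, y, z, w}) \<ge> 17"
proof -
  let ?S = "restricted_signed_sumset 3 {x, y, z, w}"
  have in_S: "e * y + f * z + g * w \<in> ?S" "e * x + f * z + g * w \<in> ?S"
    "e * x + f * y + g * w \<in> ?S" "e * x + f * y + g * z \<in> ?S"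
    if "e \<in> {-1, 1}" "f \<in> {-1, 1}" "g \<in> {-1, 1}" for e f g
    using assms that restricted_signed_sumset_three_of_four[of y z w x e f g]
      restricted_signed_sumset_three_of_four[of x z w y e f g]
      restricted_signed_sumset_three_of_four[of x y w z e f g]
      restricted_signed_sumset_three_of_four[of x y z w e f g]
    by (simp_all add: insert_commute)
  \<comment> \<open>Listed in strictly decreasing order. The last entry is nonnegative by
    \<open>y + z \<le> w\<close> and may be 0.\<close>
  let ?C = "{w + z + y, w + z + x, w + y + x, w + y - x, w - y + x, w - y - x, w - z - x, w - z - y}"
  have "?C \<subseteq> ?S"
    using in_S(1)[of 1 1 1] in_S(2)[of 1 1 1] in_S(3)[of 1 1 1] in_S(3)[of "-1" 1 1]
      in_S(3)[of 1 "-1" 1] in_S(3)[of "-1" "-1" 1] in_S(2)[of "-1" "-1" 1] in_S(1)[of "-1" "-1" 1]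
    by (simp add: algebra_simps)
  moreover have cardC: "card ?C = 8" using assms by simp
  moreover obtain c where "c \<in> ?S" "c > 0" "c \<notin> ?C"
  proof -
    \<comment> \<open>Each of the first three cases excludes the only possible collision of its
      witness with \<open>?C\<close>: \<open>w + z - x\<close> can only equal
      \<open>w + y + x\<close>; if \<open>z = y + 2 * x\<close>, then
      \<open>w + z - y = w + 2 * x\<close> can only equal \<open>w + y - x\<close>; if also
      \<open>y = 3 * x\<close>, then \<open>z - y - x = x\<close> can only equal
      \<open>w - z - y = w - 8 * x\<close>. In the last case \<open>?C\<close> consists of the
      multiples of \<open>x\<close> by 17, 15, 13, 11, 7, 5, 3, 1, so
      \<open>x + y + z = 9 * x\<close> is missing.\<close>
    consider "z \<noteq> y + 2 * x" | "z = y + 2 * x" "y \<noteq> 3 * x"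
      | "y = 3 * x" "z = 5 * x" "w \<noteq> 9 * x" | "y = 3 * x" "z = 5 * x" "w = 9 * x"
      by force
    then show ?thesis
    proof cases
      case 1
      then show ?thesis
        using that[of "w + z - x"] in_S(2)[of "-1" 1 1] assms by (simp add: algebra_simps)
    next
      case 2
      then show ?thesis
        using that[of "w + z - y"] in_S(1)[of "-1" 1 1] assms by (simp add: algebra_simps)
    next
      case 3
      then show ?thesis
        using that[of x] in_S(4)[of "-1" "-1" 1] assms by (simp add: algebra_simps)
    next
      case 4
      then show ?thesis
        using that[of "9 * x"] in_S(4)[of 1 1 1] assms by (simp add: algebra_simps)
    qed
  qed
  ultimately have "2 * card (insert c ?C) \<le> card ?S + 1"
    using assms
    by (intro card_symmetric_ge finite_restricted_signed_sumset uminus_restricted_signed_sumset) auto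
  moreover have "card (insert c ?C) = 9"
    using \<open>c \<notin> ?C\<close> cardC card_insert_disjoint[of ?C c] by simp
  ultimately show ?thesis by linarith
qed

lemma card_restricted_signed_sumset_insert:
  assumes "finite A" "\<forall>a\<in>A. a \<ge> 0" "b \<notin> A" "\<Sum>A < 2 * b"
  shows "3 * card (restricted_signed_sumset h A)
    \<le> 2 * card (restricted_signed_sumset (Suc h) (insert b A))"
proof -
  let ?S = "restricted_signed_sumset h A"
  let ?P = "{s \<in> ?S. s \<ge> 0}"
  have fin: "finite ?S" using assms(1) by (rule finite_restricted_signed_sumset)
  \<comment> \<open>A common value \<open>s - b = p + b\<close> with \<open>p \<ge> 0\<close> would
    give \<open>s \<ge> 2 * b\<close>, which exceeds \<open>\<Sum>A\<close>.\<close>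
  have "(\<lambda>s. s - b) ` ?S \<inter> (\<lambda>s. s + b) ` ?P = {}"
    using restricted_signed_sumset_le_sum[OF _ assms(2), of _ h] assms(4) by fastforce
  then have "card ?S + card ?P = card ((\<lambda>s. s - b) ` ?S \<union> (\<lambda>s. s + b) ` ?P)"
    using fin by (simp add: card_Un_disjoint card_image)
  also have "\<dots> \<le> card (restricted_signed_sumset (Suc h) (insert b A))"
    using restricted_signed_sumset_insert[OF _ assms(1,3), of _ h "-1"]
      restricted_signed_sumset_insert[OF _ assms(1,3), of _ h 1] assms(1)
    by (intro card_mono finite_restricted_signed_sumset) auto
  finally show ?thesis
    using card_symmetric_le[OF fin uminus_restricted_signed_sumset] by simp
qed

text \<open>The two-term bound is preserved by induction: adding \<open>a (n + 1)\<close> to both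
  sides leaves \<open>a n + a (n + 1)\<close> on the right to be absorbed into
  \<open>a (n + 2)\<close>.\<close>

lemma sum_less_of_fibonacci_growth:
  fixes a :: "nat \<Rightarrow> int"
  assumes "n \<ge> 3" "a 1 < a 3" "\<forall>i\<in>{4..n + 1}. a i \<ge> a (i - 1) + a (i - 2)"
  shows "(\<Sum>i=1..n. a i) < a n + a (n + 1)"
  using assms
proof (induction n rule: nat_induct_at_least)
  case base
  have "(\<Sum>i=1..3. a i) = a 1 + a 2 + a 3"
    by (simp add: numeral_eq_Suc)
  moreover have "a 4 \<ge> a 3 + a 2" using bspec[OF base(2), of 4] by simp
  ultimately show ?case using base(1) by simp
next
  case (Suc n)
  have "a (n + 2) \<ge> a (n + 1) + a n" using bspec[OF Suc.prems(2), of "n + 2"] Suc.hyps by simp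
  then show ?case using Suc by simp
qed

theorem theorem2p9:
  fixes h :: nat and a :: "nat \<Rightarrow> int" and A :: "int set"
  assumes "h \<ge> 3"
    and "A = a ` {1..h + 1}"
    and "\<forall>i\<in>{1..h + 1}. a i > 0"
    and "strict_mono_on {1..h + 1} a"
    and "\<forall>i\<in>{4..h + 1}. a i \<ge> a (i - 1) + a (i - 2)"
  shows "card (restricted_signed_sumset h A) \<ge> (h + 1)^2 + 1"
  using assms
proof (induction h arbitrary: A rule: nat_induct_at_least)
  case base
  have "{1..3 + 1} = {1, 2, 3, 4 :: nat}" by auto
  then have A: "A = {a 1, a 2, a 3, a 4}" using base(1) by simp
  have "a 1 < a 2" "a 2 < a 3"
    using base(3) by (auto intro: strict_mono_onD)
  moreover have "0 < a 1" using base(2) by simp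
  moreover have "a 2 + a 3 \<le> a 4" using bspec[OF base(4), of 4] by simp
  ultimately show ?case unfolding A using card_restricted_signed_sumset_three by simp
next
  case (Suc h)
  let ?B = "a ` {1..h + 1}" and ?b = "a (h + 2)"
  have mono: "a i < a j" if "1 \<le> i" "i < j" "j \<le> h + 2" for i j
    using Suc.prems(3) that by (auto intro: strict_mono_onD)
  have "{1..Suc h + 1} = insert (h + 2) {1..h + 1}" by auto
  then have A: "A = insert ?b ?B" using Suc.prems(1) by simp
  have IH: "(h + 1)^2 + 1 \<le> card (restricted_signed_sumset h ?B)"
    using Suc.prems by (intro Suc.IH refl) (auto intro: monotone_on_subset)
  have inj: "inj_on a {1..h + 1}"
    using mono by (intro linorder_inj_onI) force+
  have "(\<Sum>i=1..h + 1. a i) < a (h + 1) + ?b"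
    using sum_less_of_fibonacci_growth[of "h + 1" a] Suc.hyps Suc.prems(4) mono[of 1 3] by simp
  \<comment> \<open>Monotonicity replaces \<open>a (h + 1)\<close> by the larger
    \<open>?b\<close>.\<close>
  then have "\<Sum>?B < 2 * ?b"
    using mono[of "h + 1" "h + 2"] inj by (simp add: sum.reindex)
  moreover have "?b \<notin> ?B"
  proof
    assume "?b \<in> ?B"
    then obtain i where "i \<in> {1..h + 1}" "?b = a i" by blast
    then show False using mono[of i "h + 2"] by simp
  qed
  moreover have "\<forall>x\<in>?B. x \<ge> 0" using Suc.prems(2) by (auto intro: less_imp_le)
  ultimately have "3 * card (restricted_signed_sumset h ?B) \<le> 2 * card (restricted_signed_sumset (Suc h) A)"
    unfolding A by (intro card_restricted_signed_sumset_insert) auto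
  with mult_le_mono2[OF IH, of 3]
  have *: "3 * ((h + 1)^2 + 1) \<le> 2 * card (restricted_signed_sumset (Suc h) A)"
    by (rule order_trans)
  show ?case
  \<comment> \<open>The factor 3/2 alone falls just short here: \<open>3 * 17 = 51\<close> while
    \<open>2 * 26 = 52\<close> is wanted. Integrality of the cardinality closes the gap.\<close>
  proof (cases "h = 3")
    case True
    then show ?thesis using * by simp
  next
    case False
    then have "4 \<le> h" using Suc.hyps by linarith
    \<comment> \<open>With \<open>h = 4 + m\<close> the right side of the next inequality exceeds
      the left by \<open>m^2 + 6 * m + 4\<close>, so comparing coefficients suffices.\<close>
    then obtain m where "h = 4 + m" using le_Suc_ex by blast
    then have "2 * ((Suc h + 1)^2 + 1) \<le> 3 * ((h + 1)^2 + 1)"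
      by (simp add: power2_eq_square algebra_simps)
    from order_trans[OF this *] show ?thesis
      by (rule mult_left_le_imp_le) simp
  qed
qed

end
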